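(* Let $G$ be a connected graph, $p\ge1$, $\alpha\in(0,1)$, $\mu\in\mathbb{R}^{2p}$, and let $\Sigma\in\mathbb{R}^{2p\times 2p}$ be symmetric positive definite. Let $\mathcal{T}_\alpha=\{\theta\in\mathbb{R}^{2p}:(\theta-\mu)^\top\Sigma^{-1}(\theta-\mu)\le\chi^2_{2p}(\alpha)\}$. Suppose $F_G(\mu)\ge r^*C_{\max}$ for a real number $r^*$. Let $\Theta$ be a random variable supported on $\mathcal{T}_\alpha$. Then $$\mathbb{E}[F_G(\Theta)]\ \ge\ r^*C_{\max}-L_G\sqrt{\chi^2_{2p}(\alpha)\,\|\Sigma\|_{\mathrm{op}}}.$$
   Context: $G=(V,E)$ is a finite simple unweighted graph with $|V|=n$ and $|E|=m$. On $(\mathbb{C}^2)^{\otimes n}$ let $Z_i,X_i$ be Pauli operators on qubit $i$, $C=\sum_{(i,j)\in E}\frac12(I-Z_iZ_j)$, $B=\sum_iX_i$. For $\theta=(\gamma,\beta)\in\mathbb{R}^{2p}$, $|\theta\rangle=e^{-i\beta_pB}e^{-i\gamma_pC}\cdots e^{-i\beta_1B}e^{-i\gamma_1C}|+\rangle^{\otimes n}$ and $F_G(\theta)=\langle\theta|C|\theta\rangle$ is the depth-$p$ QAOA objective. $C_{\max}$ is the maximum cut value of $G$, i.e. the maximum over $z\in\{\pm1\}^n$ of $\sum_{(i,j)\in E}\frac12(1-z_iz_j)$. $\chi^2_{2p}(\alpha)$ is the $\alpha$-quantile of the chi-square distribution with $2p$ degrees of freedom. $L_G:=\sup_{\theta\in\mathbb{R}^{2p}}\|\nabla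 F_G(\theta)\|_2$ is the global Lipschitz constant of $F_G$. $\|\cdot\|_{\mathrm{op}}$ is the operator norm. *)

theory Defs
  imports "HOL-Probability.Probability" "HOL-Library.Uprod"
begin

section \<open>Graphs\<close>

text \<open>The vertex set is the universe of a finite type \<open>'v\<close>, so \<open>n = CARD('v)\<close>. A set of unordered
  pairs has no multiple edges, and \<^const>\<open>proper_uprod\<close> excludes loops.\<close>

definition simple_graph :: "'v uprod set \<Rightarrow> bool" where
  "simple_graph E \<longleftrightarrow> (\<forall>e\<in>E. proper_uprod e)"

definition connected_graph :: "'v uprod set \<Rightarrow> bool" where
  "connected_graph E \<longleftrightarrow> (\<forall>u v. (u, v) \<in> {(i, j). Upair i j \<in> E}\<^sup>*)"

lift_definition edge_cut :: "('v \<Rightarrow> real) \<Rightarrow> 'v uprod \<Rightarrow> real"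
  is "\<lambda>z (i, j). (1 - z i * z j) / 2"
  by (auto simp: mult.commute)

lemma edge_cut_Upair [simp]: "edge_cut z (Upair i j) = (1 - z i * z j) / 2"
  by transfer simp

definition max_cut :: "'v::finite uprod set \<Rightarrow> real" where
  "max_cut E = Max {\<Sum>e\<in>E. edge_cut z e | z. \<forall>v. z v \<in> {-1, 1}}"

section \<open>Operators on qubits\<close>

text \<open>The space of qubits indexed by \<open>'v\<close>, i.e. the tensor power of \<open>complex^2\<close>, has the
  computational basis \<open>'v \<Rightarrow> 2\<close>. Tensor products are given by their coordinates in it.\<close>

type_synonym 'v qstate = "complex^('v \<Rightarrow> 2)"
type_synonym 'v qop = "complex^('v \<Rightarrow> 2)^('v \<Rightarrow> 2)"

definition tensor_state :: "('v \<Rightarrow> complex^2) \<Rightarrow> 'v::finite qstate" where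
  "tensor_state \<phi> = (\<chi> x. \<Prod>v\<in>UNIV. \<phi> v $ x v)"

definition tensor_op :: "('v \<Rightarrow> complex^2^2) \<Rightarrow> 'v::finite qop" where
  "tensor_op A = (\<chi> x y. \<Prod>v\<in>UNIV. A v $ x v $ y v)"

definition on_qubit :: "complex^2^2 \<Rightarrow> 'v \<Rightarrow> 'v::finite qop" where
  "on_qubit A i = tensor_op (\<lambda>v. if v = i then A else mat 1)"

definition sigma_x :: "complex^2^2" where
  "sigma_x = vector [vector [0, 1], vector [1, 0]]"

definition sigma_z :: "complex^2^2" where
  "sigma_z = vector [vector [1, 0], vector [0, -1]]"

abbreviation pauli_X :: "'v \<Rightarrow> 'v::finite qop" where
  "pauli_X i \<equiv> on_qubit sigma_x i"

abbreviation pauli_Z :: "'v \<Rightarrow> 'v::finite qop" where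
  "pauli_Z i \<equiv> on_qubit sigma_z i"

lemma tensor_op_mult:
  "tensor_op A ** tensor_op B = tensor_op (\<lambda>v::'v::finite. A v ** B v)"
proof -
  have "(\<Sum>y\<in>UNIV. (\<Prod>v\<in>UNIV. A v $ x v $ y v) * (\<Prod>v\<in>UNIV. B v $ y v $ z v)) =
        (\<Prod>v\<in>UNIV. \<Sum>c\<in>UNIV. A v $ x v $ c * B v $ c $ z v)" for x z :: "'v \<Rightarrow> 2"
    by (subst prod_sum_PiE) (simp_all flip: prod.distrib)
  then show ?thesis
    by (simp add: tensor_op_def matrix_matrix_mult_def vec_eq_iff)
qed

lemma pauli_Z_commute: "pauli_Z i ** pauli_Z j = pauli_Z j ** pauli_Z i"
  unfolding on_qubit_def tensor_op_mult by (rule arg_cong[where f = tensor_op]) auto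

lift_definition edge_hamiltonian :: "'v uprod \<Rightarrow> 'v::finite qop"
  is "\<lambda>(i, j). (1 / 2) *\<^sub>R (mat 1 - pauli_Z i ** pauli_Z j)"
  by (auto simp: pauli_Z_commute)

lemma edge_hamiltonian_Upair [simp]:
  "edge_hamiltonian (Upair i j) = (1 / 2) *\<^sub>R (mat 1 - pauli_Z i ** pauli_Z j)"
  by transfer simp

definition cost_hamiltonian :: "'v::finite uprod set \<Rightarrow> 'v qop" where
  "cost_hamiltonian E = (\<Sum>e\<in>E. edge_hamiltonian e)"

definition mixer_hamiltonian :: "'v::finite qop" where
  "mixer_hamiltonian = (\<Sum>i\<in>UNIV. pauli_X i)"

definition matrix_exp :: "complex^'n^'n \<Rightarrow> complex^'n^'n" where
  "matrix_exp A = (\<Sum>k. (1 / fact k) *\<^sub>R (((**) A ^^ k) (mat 1)))"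

definition evolution :: "real \<Rightarrow> complex^'n^'n \<Rightarrow> complex^'n^'n" where
  "evolution t H = matrix_exp (map_matrix (\<lambda>h. - \<i> * complex_of_real t * h) H)"

definition braket :: "complex^'n \<Rightarrow> complex^'n \<Rightarrow> complex" where
  "braket \<phi> \<psi> = (\<Sum>x\<in>UNIV. cnj (\<phi> $ x) * \<psi> $ x)"

section \<open>The depth-\<open>p\<close> QAOA objective\<close>

text \<open>The layers are indexed by a finite linearly ordered type \<open>'p\<close> with \<open>p = CARD('p)\<close>. A parameter
  \<open>\<theta> = (\<gamma>, \<beta>)\<close> in \<open>\<real>\<^sup>2\<^sup>p\<close> has the coordinates \<open>\<gamma>\<^sub>k = \<theta> $ Inl k\<close> and \<open>\<beta>\<^sub>k = \<theta> $ Inr k\<close>.\<close>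

definition plus_state :: "'v::finite qstate" where
  "plus_state = tensor_state (\<lambda>_. vector [1 / complex_of_real (sqrt 2), 1 / complex_of_real (sqrt 2)])"

definition qaoa_layer :: "'v::finite uprod set \<Rightarrow> real \<Rightarrow> real \<Rightarrow> 'v qstate \<Rightarrow> 'v qstate" where
  "qaoa_layer E \<gamma> \<beta> \<psi> =
     evolution \<beta> mixer_hamiltonian *v (evolution \<gamma> (cost_hamiltonian E) *v \<psi>)"

definition qaoa_state ::
  "'v::finite uprod set \<Rightarrow> real^('p::{finite,linorder} + 'p) \<Rightarrow> 'v qstate" where
  "qaoa_state E \<theta> =
     fold (\<lambda>k. qaoa_layer E (\<theta> $ Inl k) (\<theta> $ Inr k)) (sorted_list_of_set UNIV) plus_state"

text \<open>The cost Hamiltonian is Hermitian, so taking the real part only changes the type.\<close>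

definition qaoa_objective ::
  "'v::finite uprod set \<Rightarrow> real^('p::{finite,linorder} + 'p) \<Rightarrow> real" where
  "qaoa_objective E \<theta> =
     Re (braket (qaoa_state E \<theta>) (cost_hamiltonian E *v qaoa_state E \<theta>))"

definition gradient :: "('a::real_inner \<Rightarrow> real) \<Rightarrow> 'a \<Rightarrow> 'a" where
  "gradient f x = (THE D. GDERIV f x :> D)"

definition lipschitz_const :: "('a::real_inner \<Rightarrow> real) \<Rightarrow> real" where
  "lipschitz_const f = (SUP x. norm (gradient f x))"

section \<open>Chi-square quantiles and the ellipsoid\<close>

text \<open>The chi-square distribution with \<open>k\<close> degrees of freedom is the law of the sum of the squares of
  \<open>k\<close> independent standard normal variables.\<close>

definition chi_square :: "nat \<Rightarrow> real measure" where
  "chi_square k =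
     distr (Pi\<^sub>M {..<k} (\<lambda>_. density lborel std_normal_density)) borel (\<lambda>x. \<Sum>i<k. (x i)\<^sup>2)"

definition quantile :: "real measure \<Rightarrow> real \<Rightarrow> real" where
  "quantile M \<alpha> = Inf {x. \<alpha> \<le> cdf M x}"

definition sym_pos_def :: "real^'n^'n \<Rightarrow> bool" where
  "sym_pos_def S \<longleftrightarrow> transpose S = S \<and> (\<forall>x. x \<noteq> 0 \<longrightarrow> 0 < x \<bullet> (S *v x))"

definition trust_region :: "real^'n \<Rightarrow> real^'n^'n \<Rightarrow> real \<Rightarrow> (real^'n) set" where
  "trust_region \<mu> S \<alpha> =
     {\<theta>. (\<theta> - \<mu>) \<bullet> (matrix_inv S *v (\<theta> - \<mu>)) \<le> quantile (chi_square CARD('n)) \<alpha>}"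

end

theory Submission
  imports Defs
begin

text \<open>A Hermitian \<open>H\<close> has a unitary evolution \<open>exp (- \<i> t H)\<close>, because its column norms have zero
  derivative in \<open>t\<close>. Hence the entries of the evolution and their derivatives are bounded, and so are
  the QAOA objective and its derivative. In particular the supremum defining the Lipschitz constant is
  finite, and \<open>F\<close> varies by at most \<open>L * norm (\<theta> - \<mu>)\<close> from its value at \<open>\<mu>\<close>. On the ellipsoid,
  \<open>(norm (\<theta> - \<mu>))\<^sup>2 \<le> onorm S * q\<close>, where \<open>q\<close> is the quantile. The resulting pointwise lower bound on
  \<open>F\<close> is then integrated.\<close>

section \<open>The matrix exponential as an entrywise power series\<close>

abbreviation matrix_power :: "complex^'n^'n \<Rightarrow> nat \<Rightarrow> complex^'n^'n" where
  "matrix_power H k \<equiv> ((**) H ^^ k) (mat 1)"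

lemma matrix_power_Suc_entry:
  "matrix_power H (Suc k) $ x $ y = (\<Sum>a\<in>UNIV. H $ x $ a * matrix_power H k $ a $ y)"
  by (simp add: matrix_matrix_mult_def)

lemma matrix_power_scale:
  "matrix_power (map_matrix (\<lambda>h. z * h) H) k $ x $ y = z ^ k * matrix_power H k $ x $ y"
proof (induction k arbitrary: x)
  case (Suc k)
  show ?case
    unfolding matrix_power_Suc_entry Suc by (simp add: sum_distrib_left mult_ac)
qed simp

text \<open>The sum of all entry norms dominates each row sum, so every multiplication by
  \<open>H\<close> costs at most one such factor. Any geometric bound suffices, since the factorials
  absorb it.\<close>

lemma norm_matrix_power_le:
  fixes H :: "complex^'n^'n"
  shows "norm (matrix_power H k $ x $ y) \<le> (\<Sum>a\<in>UNIV. \<Sum>b\<in>UNIV. norm (H $ a $ b)) ^ k"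
proof (induction k arbitrary: x)
  case 0
  show ?case by (simp add: mat_def)
next
  case (Suc k)
  let ?K = "\<Sum>a\<in>UNIV. \<Sum>b\<in>UNIV. norm (H $ a $ b)"
  have "norm (matrix_power H (Suc k) $ x $ y)
      \<le> (\<Sum>z\<in>UNIV. norm (H $ x $ z) * norm (matrix_power H k $ z $ y))"
    unfolding matrix_power_Suc_entry norm_mult[symmetric] by (rule norm_sum)
  also have "\<dots> \<le> (\<Sum>z\<in>UNIV. norm (H $ x $ z) * ?K ^ k)"
    by (intro sum_mono mult_left_mono Suc) simp
  also have "\<dots> = (\<Sum>z\<in>UNIV. norm (H $ x $ z)) * ?K ^ k"
    by (simp add: sum_distrib_right)
  also have "\<dots> \<le> ?K * ?K ^ k"
    by (intro mult_right_mono member_le_sum[of x UNIV "\<lambda>x. \<Sum>z\<in>UNIV. norm (H $ x $ z)"])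
      (auto intro!: sum_nonneg zero_le_power)
  finally show ?case by simp
qed

lemma summable_matrix_power_entry:
  fixes H :: "complex^'n^'n"
  shows "summable (\<lambda>k. matrix_power H k $ x $ y / fact k * z ^ k)"
proof -
  obtain K where K: "\<And>k. norm (matrix_power H k $ x $ y) \<le> K ^ k"
    using norm_matrix_power_le by metis
  show ?thesis
  proof (rule summable_comparison_test')
    show "summable (\<lambda>k. inverse (fact k) * (K * norm z) ^ k)"
      by (rule summable_exp)
    have "norm (matrix_power H k $ x $ y) * (norm z ^ k / fact k) \<le> K ^ k * (norm z ^ k / fact k)" for k
      by (rule mult_right_mono[OF K]) simp
    then show "norm (matrix_power H k $ x $ y / fact k * z ^ k) \<le> inverse (fact k) * (K * norm z) ^ k"
      for k
      by (simp add: norm_mult norm_divide norm_power power_mult_distrib field_simps)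
  qed
qed

text \<open>Convergence is entrywise, so each entry is a scalar power series in \<open>z\<close>,
  open to termwise differentiation.\<close>

lemma matrix_exp_scale_entry:
  "matrix_exp (map_matrix (\<lambda>h. z * h) H) $ x $ y
    = (\<Sum>k. matrix_power H k $ x $ y / fact k * z ^ k)"
proof -
  let ?f = "\<lambda>k. (1 / fact k) *\<^sub>R matrix_power (map_matrix (\<lambda>h. z * h) H) k"
  let ?g = "\<lambda>x y k. matrix_power H k $ x $ y / fact k * z ^ k"
  have "?f k $ x $ y = ?g x y k" for k x y
    by (simp add: matrix_power_scale) (simp add: scaleR_conv_of_real)
  then have "?f sums (\<chi> x y. \<Sum>k. ?g x y k)"
    unfolding sums_def
    by (intro vec_tendstoI)
      (simp only: vec_lambda_beta sum_component summable_LIMSEQ summable_matrix_power_entry)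
  then show ?thesis
    by (simp add: matrix_exp_def sums_unique[symmetric])
qed

text \<open>Entrywise form of \<open>U' = H U\<close>: differentiating shifts the coefficients by
  one, and the shifted matrix power splits off a factor \<open>H\<close>.\<close>

lemma has_field_derivative_matrix_exp:
  fixes H :: "complex^'n^'n"
  defines "U \<equiv> \<lambda>z. matrix_exp (map_matrix (\<lambda>h. z * h) H)"
  shows "((\<lambda>z. U z $ x $ y) has_field_derivative (\<Sum>a\<in>UNIV. H $ x $ a * U z $ a $ y)) (at z)"
proof -
  let ?c = "\<lambda>x k. matrix_power H k $ x $ y / fact k"
  have "diffs (?c x) k = (\<Sum>a\<in>UNIV. H $ x $ a * ?c a k)" for k
  proof -
    \<comment> \<open>The factor produced by \<open>diffs\<close> cancels the top factor of the
      factorial.\<close>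
    have "of_nat (Suc k) * (w / fact (Suc k)) = w / fact k" for w :: complex
      by (simp del: of_nat_Suc)
    then show ?thesis
      unfolding diffs_def by (simp add: matrix_matrix_mult_def sum_divide_distrib[symmetric] del: of_nat_Suc fact_Suc)
  qed
  then have "(\<Sum>k. diffs (?c x) k * z ^ k) = (\<Sum>k. \<Sum>a\<in>UNIV. H $ x $ a * (?c a k * z ^ k))"
    by (simp add: sum_distrib_right mult.assoc)
  also have "\<dots> = (\<Sum>a\<in>UNIV. \<Sum>k. H $ x $ a * (?c a k * z ^ k))"
    by (intro suminf_sum summable_mult summable_matrix_power_entry)
  also have "\<dots> = (\<Sum>a\<in>UNIV. H $ x $ a * U z $ a $ y)"
    unfolding U_def matrix_exp_scale_entry
    by (intro sum.cong refl suminf_mult summable_matrix_power_entry)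
  finally have eq: "(\<Sum>k. diffs (?c x) k * z ^ k) = (\<Sum>a\<in>UNIV. H $ x $ a * U z $ a $ y)" .
  have "((\<lambda>z. U z $ x $ y) has_field_derivative (\<Sum>k. diffs (?c x) k * z ^ k)) (at z)"
    unfolding U_def matrix_exp_scale_entry
    by (rule termdiffs_strong_converges_everywhere) (rule summable_matrix_power_entry)
  then show ?thesis
    unfolding eq .
qed

section \<open>Hermitian matrices and their unitary evolution\<close>

definition hermitian :: "complex^'n^'n \<Rightarrow> bool" where
  "hermitian H \<longleftrightarrow> (\<forall>x y. cnj (H $ y $ x) = H $ x $ y)"

lemma hermitianD: "hermitian H \<Longrightarrow> cnj (H $ y $ x) = H $ x $ y"
  by (simp add: hermitian_def)

lemma hermitianI: "(\<And>x y. cnj (H $ y $ x) = H $ x $ y) \<Longrightarrow> hermitian H"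
  by (simp add: hermitian_def)

text \<open>The Schroedinger equation, by the chain rule along the line
  \<open>z = - \<i> * t\<close>.\<close>

lemma has_vector_derivative_evolution:
  "((\<lambda>t. evolution t H $ x $ y) has_vector_derivative
    (- \<i> * (\<Sum>a\<in>UNIV. H $ x $ a * evolution t H $ a $ y))) (at t)"
proof -
  have "((\<lambda>t. - \<i> * complex_of_real t) has_vector_derivative - \<i>) (at t)"
    by (auto intro!: derivative_eq_intros)
  from field_vector_diff_chain_at[OF this has_field_derivative_matrix_exp[of H x y]]
  show ?thesis
    unfolding evolution_def o_def .
qed

lemma evolution_0: "evolution 0 H = mat 1"
proof -
  have "evolution 0 H $ x $ y = (mat 1 :: complex^'a^'a) $ x $ y" for x y
    unfolding evolution_def of_real_0 mult_zero_right matrix_exp_scale_entry powser_zero by simp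
  then show ?thesis
    by (simp add: vec_eq_iff)
qed

lemma sum_norm_evolution_column:
  fixes H :: "complex^'n^'n"
  assumes "hermitian H"
  shows "(\<Sum>x\<in>UNIV. evolution t H $ x $ y * cnj (evolution t H $ x $ y)) = 1"
proof -
  let ?u = "\<lambda>t x. evolution t H $ x $ y"
  let ?d = "\<lambda>t x. - \<i> * (\<Sum>a\<in>UNIV. H $ x $ a * ?u t a)"
  have *: "(\<Sum>x\<in>UNIV. ?u t x * cnj (?d t x) + ?d t x * cnj (?u t x)) = 0" for t
  proof -
    let ?I = "\<Sum>x\<in>UNIV. \<Sum>a\<in>UNIV. H $ x $ a * ?u t a * cnj (?u t x)"
    let ?J = "\<Sum>x\<in>UNIV. \<Sum>a\<in>UNIV. cnj (H $ x $ a) * ?u t x * cnj (?u t a)"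
    \<comment> \<open>For Hermitian \<open>H\<close> the two double sums differ only in the order of
      summation.\<close>
    have IJ: "?I = ?J"
      unfolding hermitianD[OF assms] by (rule sum.swap)
    have left: "(\<Sum>x\<in>UNIV. ?u t x * cnj (?d t x)) = \<i> * ?J"
      by (simp add: sum_distrib_left mult_ac)
    have right: "(\<Sum>x\<in>UNIV. ?d t x * cnj (?u t x)) = - \<i> * ?I"
      by (simp add: sum_distrib_left sum_distrib_right sum_negf mult_ac)
    show ?thesis
      unfolding sum.distrib left right IJ by simp
  qed
  have "((\<lambda>t. \<Sum>x\<in>UNIV. ?u t x * cnj (?u t x)) has_vector_derivative
      (\<Sum>x\<in>UNIV. ?u t x * cnj (?d t x) + ?d t x * cnj (?u t x))) (at t within UNIV)" for t
    by (intro has_vector_derivative_sum has_vector_derivative_mult has_vector_derivative_cnj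
        has_vector_derivative_evolution)
  then obtain c where c: "\<And>t. (\<Sum>x\<in>UNIV. ?u t x * cnj (?u t x)) = c"
    unfolding * using has_vector_derivative_zero_constant[of UNIV] by auto
  moreover have "(\<Sum>x\<in>UNIV. ?u 0 x * cnj (?u 0 x)) = 1"
    by (simp add: evolution_0 mat_def if_distrib if_distribR cong: if_cong)
  ultimately show ?thesis by metis
qed

lemma norm_evolution_le:
  assumes "hermitian H"
  shows "norm (evolution t H $ x $ y) \<le> 1"
proof -
  have "(\<Sum>x\<in>UNIV. (norm (evolution t H $ x $ y))\<^sup>2) = 1"
    using sum_norm_evolution_column[OF assms, of t y]
    by (simp add: complex_norm_square[symmetric] flip: of_real_sum of_real_power)
  then have "(norm (evolution t H $ x $ y))\<^sup>2 \<le> 1"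
    using member_le_sum[of x UNIV "\<lambda>x. (norm (evolution t H $ x $ y))\<^sup>2"] by simp
  then show ?thesis
    by (simp add: power_le_one_iff abs_square_le_1)
qed

section \<open>The QAOA Hamiltonians are Hermitian\<close>

lemma hermitian_sum: "(\<And>i. i \<in> I \<Longrightarrow> hermitian (A i)) \<Longrightarrow> hermitian (\<Sum>i\<in>I. A i)"
  by (rule hermitianI) (simp add: hermitianD)

lemma hermitian_tensor_op: "(\<And>v. hermitian (A v)) \<Longrightarrow> hermitian (tensor_op A)"
  by (rule hermitianI) (simp add: tensor_op_def hermitianD)

lemma hermitian_mat_1: "hermitian (mat 1)"
  by (simp add: hermitian_def mat_def eq_commute)

lemma hermitian_on_qubit: "hermitian A \<Longrightarrow> hermitian (on_qubit A i)"
  by (simp add: on_qubit_def hermitian_tensor_op hermitian_mat_1)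

text \<open>Taking adjoints reverses a product; commutation restores the order.\<close>

lemma hermitian_mult:
  assumes "hermitian A" "hermitian B" "A ** B = B ** A"
  shows "hermitian (A ** B)"
proof (rule hermitianI)
  fix x y
  have "cnj ((A ** B) $ y $ x) = (B ** A) $ x $ y"
    using assms(1,2) by (simp add: matrix_matrix_mult_def hermitianD mult.commute)
  then show "cnj ((A ** B) $ y $ x) = (A ** B) $ x $ y"
    by (simp only: assms(3))
qed

lemma hermitian_sigma_x: "hermitian sigma_x"
  by (simp add: hermitian_def sigma_x_def forall_2)

lemma hermitian_sigma_z: "hermitian sigma_z"
  by (simp add: hermitian_def sigma_z_def forall_2)

lemma hermitian_edge_hamiltonian: "hermitian (edge_hamiltonian e)"
proof (cases e)
  case (Upair i j)
  have "hermitian (pauli_Z i ** pauli_Z j)"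
    by (intro hermitian_mult hermitian_on_qubit hermitian_sigma_z pauli_Z_commute)
  then show ?thesis
    unfolding Upair edge_hamiltonian_Upair
    by (intro hermitianI) (simp add: hermitianD hermitian_mat_1)
qed

lemma hermitian_cost_hamiltonian: "hermitian (cost_hamiltonian E)"
  unfolding cost_hamiltonian_def by (intro hermitian_sum hermitian_edge_hamiltonian)

lemma hermitian_mixer_hamiltonian: "hermitian mixer_hamiltonian"
  unfolding mixer_hamiltonian_def by (intro hermitian_sum hermitian_on_qubit hermitian_sigma_x)

section \<open>Bounded functions with bounded derivative\<close>

text \<open>Bounding the values along with the derivative makes the class closed under products.
  Continuity of the derivative is not demanded, despite the name.\<close>

definition bounded_C1 :: "('a::real_normed_vector \<Rightarrow> 'b::real_normed_vector) \<Rightarrow> bool" where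
  "bounded_C1 f \<longleftrightarrow> (\<exists>B f'. \<forall>x. norm (f x) \<le> B \<and> (f has_derivative f' x) (at x) \<and>
     (\<forall>h. norm (f' x h) \<le> B * norm h))"

lemma bounded_C1I:
  assumes "\<And>x. norm (f x) \<le> B" "\<And>x. (f has_derivative f' x) (at x)"
    "\<And>x h. norm (f' x h) \<le> C * norm h"
  shows "bounded_C1 f"
proof -
  have "norm (f' x h) \<le> max B C * norm h" for x h
    using assms(3)[of x h] mult_right_mono[of C "max B C" "norm h"] by simp
  then show ?thesis
    unfolding bounded_C1_def using assms(1,2) by (metis max.coboundedI1)
qed

lemma bounded_C1E:
  assumes "bounded_C1 f"
  obtains B f' where "0 \<le> B" "\<And>x. norm (f x) \<le> B" "\<And>x. (f has_derivative f' x) (at x)"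
    "\<And>x h. norm (f' x h) \<le> B * norm h"
  using assms unfolding bounded_C1_def by (metis norm_ge_zero order_trans)

lemma bounded_C1_const: "bounded_C1 (\<lambda>_. c)"
  by (rule bounded_C1I[of _ "norm c" "\<lambda>_ _. 0" 0]) auto

lemma bounded_C1_add:
  assumes "bounded_C1 f" "bounded_C1 g"
  shows "bounded_C1 (\<lambda>x. f x + g x)"
proof -
  obtain B f' where f: "\<And>x. norm (f x) \<le> B" "\<And>x. (f has_derivative f' x) (at x)"
    "\<And>x h. norm (f' x h) \<le> B * norm h" using bounded_C1E[OF assms(1)] by metis
  obtain C g' where g: "\<And>x. norm (g x) \<le> C" "\<And>x. (g has_derivative g' x) (at x)"
    "\<And>x h. norm (g' x h) \<le> C * norm h" using bounded_C1E[OF assms(2)] by metis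
  show ?thesis
    by (rule bounded_C1I[of _ "B + C" "\<lambda>x h. f' x h + g' x h" "B + C"])
      (auto intro!: norm_triangle_mono has_derivative_add f g simp: distrib_right)
qed

lemma bounded_C1_sum:
  "(\<And>i. i \<in> I \<Longrightarrow> bounded_C1 (f i)) \<Longrightarrow> bounded_C1 (\<lambda>x. \<Sum>i\<in>I. f i x)"
  by (induction I rule: infinite_finite_induct) (simp_all add: bounded_C1_const bounded_C1_add)

lemma bounded_C1_mult:
  fixes f g :: "'a::real_normed_vector \<Rightarrow> 'b::real_normed_algebra"
  assumes "bounded_C1 f" "bounded_C1 g"
  shows "bounded_C1 (\<lambda>x. f x * g x)"
proof -
  obtain B f' where f: "0 \<le> B" "\<And>x. norm (f x) \<le> B" "\<And>x. (f has_derivative f' x) (at x)"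
    "\<And>x h. norm (f' x h) \<le> B * norm h" using bounded_C1E[OF assms(1)] by metis
  obtain C g' where g: "0 \<le> C" "\<And>x. norm (g x) \<le> C" "\<And>x. (g has_derivative g' x) (at x)"
    "\<And>x h. norm (g' x h) \<le> C * norm h" using bounded_C1E[OF assms(2)] by metis
  have *: "norm (a * b) \<le> c * d" if "norm a \<le> c" "norm b \<le> d" for a b :: 'b and c d
    using that by (meson mult_mono' norm_ge_zero norm_mult_ineq order_trans)
  show ?thesis
  proof (rule bounded_C1I)
    show "norm (f x * g x) \<le> B * C" for x
      by (intro * f g)
    show "((\<lambda>x. f x * g x) has_derivative (\<lambda>h. f x * g' x h + f' x h * g x)) (at x)" for x
      by (intro has_derivative_mult f g)
    \<comment> \<open>Each of the two terms of the product rule is at most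
      \<open>B * C * norm h\<close>.\<close>
    show "norm (f x * g' x h + f' x h * g x) \<le> 2 * B * C * norm h" for x h
      using norm_triangle_mono[OF *[OF f(2)[of x] g(4)[of x h]] *[OF f(4)[of x h] g(2)[of x]]]
      by (simp add: mult_ac)
  qed
qed

lemma bounded_C1_bounded_linear:
  assumes "bounded_linear L" "bounded_C1 f"
  shows "bounded_C1 (\<lambda>x. L (f x))"
proof -
  obtain B f' where f: "\<And>x. norm (f x) \<le> B" "\<And>x. (f has_derivative f' x) (at x)"
    "\<And>x h. norm (f' x h) \<le> B * norm h" using bounded_C1E[OF assms(2)] by metis
  obtain K where K: "0 \<le> K" "\<And>x. norm (L x) \<le> norm x * K"
    using bounded_linear.nonneg_bounded[OF assms(1)] by blast
  have *: "norm (L x) \<le> K * c" if "norm x \<le> c" for x c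
    using K mult_left_mono[OF that K(1)] by (metis mult.commute order_trans)
  show ?thesis
    by (rule bounded_C1I[of _ "K * B" "\<lambda>x h. L (f' x h)" "K * B"])
      (auto intro!: * bounded_linear.has_derivative[OF assms(1)] f simp: mult.assoc)
qed

text \<open>Coordinates of the parameter are unbounded, hence not \<open>bounded_C1\<close>
  themselves; they may enter only inside a bounded function, where the chain rule needs just their
  operator bound.\<close>

lemma bounded_C1_compose_linear:
  assumes "bounded_linear L" "bounded_C1 f"
  shows "bounded_C1 (\<lambda>x. f (L x))"
proof -
  obtain B f' where f: "0 \<le> B" "\<And>x. norm (f x) \<le> B" "\<And>x. (f has_derivative f' x) (at x)"
    "\<And>x h. norm (f' x h) \<le> B * norm h" using bounded_C1E[OF assms(2)] by metis
  obtain K where K: "0 \<le> K" "\<And>x. norm (L x) \<le> norm x * K"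
    using bounded_linear.nonneg_bounded[OF assms(1)] by blast
  show ?thesis
  proof (rule bounded_C1I)
    show "norm (f (L x)) \<le> B" for x by (rule f)
    show "((\<lambda>x. f (L x)) has_derivative (\<lambda>h. f' (L x) (L h))) (at x)" for x
      by (rule has_derivative_compose[OF bounded_linear.has_derivative[OF assms(1) has_derivative_ident] f(3)])
    show "norm (f' (L x) (L h)) \<le> B * K * norm h" for x h
      using f(4)[of "L x" "L h"] mult_left_mono[OF K(2)[of h] f(1)] by (simp add: mult_ac)
  qed
qed

section \<open>Boundedness of the objective and its derivative\<close>

text \<open>Unitarity bounds the entries uniformly in \<open>t\<close>; the Schroedinger equation
  carries this over to the derivative.\<close>

lemma bounded_C1_evolution:
  fixes H :: "complex^'n^'n"
  assumes "hermitian H"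
  shows "bounded_C1 (\<lambda>t. evolution t H $ x $ y)"
proof (rule bounded_C1I)
  let ?D = "\<lambda>t. - \<i> * (\<Sum>a\<in>UNIV. H $ x $ a * evolution t H $ a $ y)"
  let ?C = "\<Sum>a\<in>UNIV. norm (H $ x $ a)"
  show "norm (evolution t H $ x $ y) \<le> 1" for t
    by (rule norm_evolution_le[OF assms])
  show "((\<lambda>t. evolution t H $ x $ y) has_derivative (\<lambda>h. h *\<^sub>R ?D t)) (at t)" for t
    using has_vector_derivative_evolution[of H x y t] by (simp add: has_vector_derivative_def)
  have le: "norm (?D t) \<le> ?C" for t
    using norm_evolution_le[OF assms] by (simp add: norm_mult) (auto intro!: sum_norm_le simp: norm_mult mult_left_le)
  show "norm (h *\<^sub>R ?D t) \<le> ?C * norm h" for t h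
    unfolding norm_scaleR real_norm_def mult.commute[of "\<bar>h\<bar>"]
    by (rule mult_right_mono[OF le abs_ge_zero])
qed

lemma bounded_C1_qaoa_layer:
  fixes \<psi> :: "'a::real_normed_vector \<Rightarrow> 'v::finite qstate"
  assumes "bounded_linear g" "bounded_linear b" "\<And>x. bounded_C1 (\<lambda>\<theta>. \<psi> \<theta> $ x)"
  shows "bounded_C1 (\<lambda>\<theta>. qaoa_layer E (g \<theta>) (b \<theta>) (\<psi> \<theta>) $ x)"
  unfolding qaoa_layer_def matrix_vector_mult_def vec_lambda_beta
  by (intro bounded_C1_sum bounded_C1_mult assms(3)
      bounded_C1_compose_linear[OF assms(1) bounded_C1_evolution] hermitian_cost_hamiltonian
      bounded_C1_compose_linear[OF assms(2) bounded_C1_evolution] hermitian_mixer_hamiltonian)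

lemma bounded_C1_qaoa_state:
  "bounded_C1 (\<lambda>\<theta> :: real^('p::{finite,linorder} + 'p). qaoa_state E \<theta> $ x)"
proof -
  \<comment> \<open>The initial state may depend on \<open>\<theta>\<close>, because
    \<open>fold\<close> passes the output of one layer, which depends on \<open>\<theta>\<close>, to
    the remaining ones.\<close>
  have "bounded_C1 (\<lambda>\<theta> :: real^('p + 'p).
      fold (\<lambda>k. qaoa_layer E (\<theta> $ Inl k) (\<theta> $ Inr k)) ks (\<psi> \<theta>) $ x)"
    if "\<And>x. bounded_C1 (\<lambda>\<theta>. \<psi> \<theta> $ x)" for ks and \<psi>
    using that
  proof (induction ks arbitrary: \<psi>)
    case (Cons k ks)
    show ?case
      using Cons.IH[OF bounded_C1_qaoa_layer[OF bounded_linear_vec_nth bounded_linear_vec_nth Cons.prems]]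
      by simp
  qed simp
  then show ?thesis
    unfolding qaoa_state_def by (simp add: bounded_C1_const)
qed

lemma bounded_C1_qaoa_objective:
  "bounded_C1 (qaoa_objective E :: real^('p::{finite,linorder} + 'p) \<Rightarrow> real)"
  unfolding qaoa_objective_def braket_def matrix_vector_mult_def vec_lambda_beta
  by (intro bounded_C1_bounded_linear[OF bounded_linear_Re] bounded_C1_sum bounded_C1_mult bounded_C1_const
      bounded_C1_bounded_linear[OF bounded_linear_cnj] bounded_C1_qaoa_state)

section \<open>Gradients and the global Lipschitz constant\<close>

lemma GDERIV_gradient:
  fixes f :: "'a::euclidean_space \<Rightarrow> real"
  assumes "f differentiable at x"
  shows "GDERIV f x :> gradient f x"
proof -
  obtain f' where f': "(f has_derivative f') (at x)"
    using assms by (auto simp: differentiable_def)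
  \<comment> \<open>Riesz representation of the functional \<open>f'\<close>: \<open>f' h\<close> is
    the real inner product of \<open>f' h\<close> with 1.\<close>
  have "f' = (\<lambda>h. h \<bullet> adjoint f' 1)"
    using adjoint_works[OF has_derivative_linear[OF f']] by simp
  then have "GDERIV f x :> adjoint f' 1"
    using f' by (simp add: gderiv_def)
  moreover have "D = D'" if "GDERIV f x :> D" "GDERIV f x :> D'" for D D'
    using has_derivative_unique that unfolding gderiv_def by (metis inner_commute vector_eq_rdot)
  ultimately show ?thesis
    unfolding gradient_def by (metis theI)
qed

text \<open>The mean value inequality on the whole space. A real supremum is meaningful only for a
  bounded set, so the gradients are bounded first.\<close>

lemma lipschitz_const_bound:
  fixes f :: "'a::euclidean_space \<Rightarrow> real"
  assumes "bounded_C1 f"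
  shows "\<bar>f x - f y\<bar> \<le> lipschitz_const f * norm (x - y)"
proof -
  obtain B f' where f: "0 \<le> B" "\<And>x. (f has_derivative f' x) (at x)"
    "\<And>x h. norm (f' x h) \<le> B * norm h" using bounded_C1E[OF assms] by metis
  have grad: "(f has_derivative (\<lambda>h. h \<bullet> gradient f x)) (at x)" for x
    using GDERIV_gradient[of f x] f(2) by (auto simp: gderiv_def differentiable_def)
  have "norm (gradient f x) \<le> B" for x
  proof -
    have "f' x = (\<lambda>h. h \<bullet> gradient f x)"
      using has_derivative_unique[OF f(2) grad] .
    \<comment> \<open>The derivative is tested in the direction of the gradient itself.\<close>
    then have "norm (gradient f x) * norm (gradient f x) \<le> B * norm (gradient f x)"
      using f(3)[of x "gradient f x"] by (simp add: norm_eq_sqrt_inner)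
    then show ?thesis
      using f(1) by (cases "gradient f x = 0") auto
  qed
  then have "norm (gradient f x) \<le> lipschitz_const f" for x
    unfolding lipschitz_const_def by (intro cSUP_upper bdd_aboveI2) auto
  then have "onorm (\<lambda>h. h \<bullet> gradient f x) \<le> lipschitz_const f" for x
    by (intro onorm_le) (metis Cauchy_Schwarz_ineq2 mult.commute mult_left_mono norm_ge_zero order_trans real_norm_def)
  then show ?thesis
    using differentiable_bound[of UNIV f "\<lambda>x h. h \<bullet> gradient f x"] grad by simp
qed

section \<open>The ellipsoid lies in a ball\<close>

text \<open>In effect Cauchy-Schwarz for the form of \<open>S\<close>, applied to \<open>v\<close>
  and the preimage \<open>w\<close> of \<open>v\<close> under \<open>S\<close>; this replaces a
  diagonalisation of \<open>S\<close>.\<close>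

lemma norm_square_le_onorm_inverse:
  fixes S :: "real^'n^'n"
  assumes "sym_pos_def S"
  shows "(norm v)\<^sup>2 \<le> (v \<bullet> (matrix_inv S *v v)) * onorm ((*v) S)"
proof (cases "v = 0")
  case False
  have pos: "0 < x \<bullet> (S *v x)" if "x \<noteq> 0" for x
    using assms that by (simp add: sym_pos_def_def)
  have "S *v x \<noteq> 0" if "x \<noteq> 0" for x
    using pos[OF that] by auto
  then have "invertible S"
    by (metis invertible_left_inverse matrix_left_invertible_ker)
  \<comment> \<open>\<open>matrix_inv\<close> is defined by choice, so its inverse property has to
    be drawn from invertibility.\<close>
  then have "S ** matrix_inv S = mat 1"
    unfolding invertible_def matrix_inv_def by (metis (mono_tags, lifting) someI_ex)
  define w where "w = matrix_inv S *v v"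
  have Sw: "S *v w = v"
    by (simp add: w_def matrix_vector_mul_assoc \<open>S ** matrix_inv S = mat 1\<close>)
  define N where "N = onorm ((*v) S)"
  have bl: "bounded_linear ((*v) S)"
    by simp
  have vSv: "v \<bullet> (S *v v) \<le> N * (norm v)\<^sup>2"
  proof -
    have "v \<bullet> (S *v v) \<le> norm v * norm (S *v v)"
      by (rule norm_cauchy_schwarz)
    also have "\<dots> \<le> norm v * (N * norm v)"
      unfolding N_def by (intro mult_left_mono onorm bl) simp
    finally show ?thesis by (simp add: power2_eq_square mult_ac)
  qed
  have "0 < N"
    using vSv pos[OF False] by (smt (verit) mult_nonpos_nonneg zero_le_power2)
  have sym: "x \<bullet> (S *v y) = (S *v x) \<bullet> y" for x y
    using assms dot_lmul_matrix[of x S y] unfolding sym_pos_def_def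
    by (metis transpose_matrix_vector)
  \<comment> \<open>Minimising \<open>(w - t v) \<bullet> S (w - t v)\<close> over \<open>t\<close>, with \<open>v \<bullet> S v\<close> bounded by \<open>N (norm v)\<^sup>2\<close>,
    gives \<open>t = 1 / N\<close>.\<close>
  let ?u = "w - (1 / N) *\<^sub>R v"
  have "0 \<le> ?u \<bullet> (S *v ?u)"
    using pos[of ?u] by (cases "?u = 0") auto
  \<comment> \<open>By symmetry and \<open>S *v w = v\<close>, both mixed terms reduce to
    \<open>v \<bullet> v\<close>, whence the factor 2.\<close>
  also have "?u \<bullet> (S *v ?u) = w \<bullet> v - 2 / N * (norm v)\<^sup>2 + (v \<bullet> (S *v v)) / N\<^sup>2"
    using sym[of w v]
    by (simp add: matrix_vector_mult_diff_distrib matrix_vector_mult_scaleR inner_diff_left inner_diff_right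
        Sw dot_square_norm power2_eq_square diff_divide_distrib)
  also have "\<dots> \<le> w \<bullet> v - 2 / N * (norm v)\<^sup>2 + (N * (norm v)\<^sup>2) / N\<^sup>2"
    using vSv by (simp add: divide_right_mono)
  also have "\<dots> = w \<bullet> v - (norm v)\<^sup>2 / N"
    using \<open>0 < N\<close> by (simp add: power2_eq_square field_simps)
  finally show ?thesis
    using \<open>0 < N\<close> by (simp add: w_def[symmetric] N_def[symmetric] inner_commute field_simps)
qed simp

section \<open>From the pointwise bound on the ellipsoid to the expectation\<close>

theorem theorem2:
  fixes E :: "'v::finite uprod set"
    and \<mu> :: "real^('p::{finite,linorder} + 'p)"
    and S :: "real^('p + 'p)^('p + 'p)"
    and \<alpha> r :: real
    and M :: "'w measure"
    and \<Theta> :: "'w \<Rightarrow> real^('p + 'p)"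
  assumes "simple_graph E" and "connected_graph E"
    and "0 < \<alpha>" and "\<alpha> < 1"
    and "sym_pos_def S"
    and "qaoa_objective E \<mu> \<ge> r * max_cut E"
    and "prob_space M"
    and "\<Theta> \<in> borel_measurable M"
    and "AE \<omega> in M. \<Theta> \<omega> \<in> trust_region \<mu> S \<alpha>"
  shows "prob_space.expectation M (\<lambda>\<omega>. qaoa_objective E (\<Theta> \<omega>)) \<ge>
    r * max_cut E
      - lipschitz_const (qaoa_objective E :: real^('p + 'p) \<Rightarrow> real)
        * sqrt (quantile (chi_square (2 * CARD('p))) \<alpha> * onorm ((*v) S))"
proof -
  interpret prob_space M by fact
  let ?F = "qaoa_objective E :: real^('p + 'p) \<Rightarrow> real"
  let ?q = "quantile (chi_square (2 * CARD('p))) \<alpha>"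
  obtain B f' where F: "\<And>\<theta>. norm (?F \<theta>) \<le> B" "\<And>\<theta>. (?F has_derivative f' \<theta>) (at \<theta>)"
    using bounded_C1E[OF bounded_C1_qaoa_objective] by metis
  have lip: "\<bar>?F x - ?F y\<bar> \<le> lipschitz_const ?F * norm (x - y)" for x y
    by (rule lipschitz_const_bound[OF bounded_C1_qaoa_objective])
  \<comment> \<open>Two points at distance 1, a unit vector and the origin, show the sign.\<close>
  have L: "0 \<le> lipschitz_const ?F"
    using order_trans[OF abs_ge_zero lip[of "axis (Inl undefined) 1" 0]] by simp
  have lower: "r * max_cut E - lipschitz_const ?F * sqrt (?q * onorm ((*v) S)) \<le> ?F \<theta>"
    if "\<theta> \<in> trust_region \<mu> S \<alpha>" for \<theta>
  proof -
    have "(norm (\<theta> - \<mu>))\<^sup>2 \<le> ((\<theta> - \<mu>) \<bullet> (matrix_inv S *v (\<theta> - \<mu>))) * onorm ((*v) S)"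
      by (rule norm_square_le_onorm_inverse[OF \<open>sym_pos_def S\<close>])
    \<comment> \<open>\<open>mult_2\<close> matches the degrees of freedom
      \<open>2 * CARD('p)\<close> with the dimension of the parameter space.\<close>
    also have "\<dots> \<le> ?q * onorm ((*v) S)"
      using that by (intro mult_right_mono onorm_pos_le) (simp_all add: trust_region_def mult_2)
    finally have "norm (\<theta> - \<mu>) \<le> sqrt (?q * onorm ((*v) S))"
      by (rule real_le_rsqrt)
    then have "lipschitz_const ?F * norm (\<theta> - \<mu>) \<le> lipschitz_const ?F * sqrt (?q * onorm ((*v) S))"
      by (rule mult_left_mono[OF _ L])
    then show ?thesis
      using lip[of \<theta> \<mu>] \<open>r * max_cut E \<le> ?F \<mu>\<close> by linarith
  qed
  have "?F \<in> borel_measurable borel"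
    using F(2) by (intro borel_measurable_continuous_onI continuous_at_imp_continuous_on)
      (auto intro: has_derivative_continuous)
  then have "(\<lambda>\<omega>. ?F (\<Theta> \<omega>)) \<in> borel_measurable M"
    using \<open>\<Theta> \<in> borel_measurable M\<close> by measurable
  \<comment> \<open>The uniform bound \<open>B\<close> gives integrability; the integral of a
    non-integrable function would be 0 by default.\<close>
  then have "integrable M (\<lambda>\<omega>. ?F (\<Theta> \<omega>))"
    using F(1) by (intro integrable_const_bound[of _ B]) auto
  then show ?thesis
    using \<open>AE \<omega> in M. \<Theta> \<omega> \<in> trust_region \<mu> S \<alpha>\<close> lower
    by (intro integral_ge_const) (auto elim: eventually_mono)
qed

end
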